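(* Let $n\geq 2$ be an integer. Then $$\chi\big(\mathcal{G}(\mathbb{Z}_n[x])\big)=\chi\big(\mathcal{G}(\mathbb{Z}_n)\big)=\begin{cases}2 & \text{if } n \text{ is even},\\ 3 & \text{if } n \text{ is odd}.\end{cases}$$
   Context: $\mathbb{Z}_n$ denotes the ring of integers modulo $n$. For a commutative ring $R$ with identity, the involutory Cayley graph $\mathcal{G}(R)$ is the simple undirected graph with vertex set $R$ in which two vertices $a,b$ are adjacent if and only if $(a-b)^2=1$. $\chi(G)$ denotes the chromatic number of a graph $G$, i.e. the minimum number of colors needed to color the vertices so that adjacent vertices receive different colors. *)

theory Defs
  imports "HOL-Number_Theory.Residues" "HOL-Algebra.UnivPoly" "HOL-Library.Extended_Nat"
begin

text \<open>An undirected graph is a set of vertices together with a set of unordered pairs of vertices.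
  The vertex set may be infinite.\<close>

type_synonym 'a ugraph = "'a set \<times> 'a set set"

abbreviation verts :: "'a ugraph \<Rightarrow> 'a set"
  where "verts G \<equiv> fst G"

abbreviation edges :: "'a ugraph \<Rightarrow> 'a set set"
  where "edges G \<equiv> snd G"

text \<open>The condition \<open>a \<noteq> b\<close> only matters for the zero ring, where it excludes a loop.\<close>

definition involutory_cayley_graph :: "('a, 'b) ring_scheme \<Rightarrow> 'a ugraph"
  where "involutory_cayley_graph R =
    (carrier R,
     {{a, b} | a b. a \<in> carrier R \<and> b \<in> carrier R \<and> a \<noteq> b \<and>
        (a \<ominus>\<^bsub>R\<^esub> b) [^]\<^bsub>R\<^esub> (2::nat) = \<one>\<^bsub>R\<^esub>})"

definition proper_coloring :: "'a ugraph \<Rightarrow> nat \<Rightarrow> ('a \<Rightarrow> nat) \<Rightarrow> bool"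
  where "proper_coloring G k c \<longleftrightarrow>
    c \<in> verts G \<rightarrow> {..<k} \<and> (\<forall>a b. {a, b} \<in> edges G \<longrightarrow> c a \<noteq> c b)"

definition colorable :: "'a ugraph \<Rightarrow> nat \<Rightarrow> bool"
  where "colorable G k \<longleftrightarrow> (\<exists>c. proper_coloring G k c)"

text \<open>The value is \<open>\<infinity>\<close> exactly if no finite number of colors suffices.\<close>

definition chromatic_number :: "'a ugraph \<Rightarrow> enat"
  where "chromatic_number G = (INF k\<in>{k. colorable G k}. enat k)"

end

theory Submission
  imports Defs
begin

text \<open>A ring homomorphism into a nontrivial ring carries \<open>(a - b)\<^sup>2 = 1\<close> to the same equation
  between the images, so it is a homomorphism of involutory Cayley graphs and can only increase the
  chromatic number: a coloring of the target pulls back.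

  For every nontrivial commutative ring \<open>R\<close> the inclusion of the constants \<open>R \<rightarrow> R[x]\<close> and
  the constant coefficient \<open>R[x] \<rightarrow> R\<close> are ring homomorphisms in opposite directions, so
  \<open>R\<close> and \<open>R[x]\<close> have the same chromatic number.

  For the upper bound on \<open>\<int>\<^sub>n\<close>, take a prime divisor \<open>p\<close> of \<open>n\<close> (with \<open>p = 2\<close> for even \<open>n\<close>)
  and reduce modulo \<open>p\<close>. In the field \<open>\<int>\<^sub>p\<close> the only square roots of 1 are 1 and -1, so its graph
  is a single edge for \<open>p = 2\<close> and the cycle of length \<open>p\<close> for odd \<open>p\<close>; these are colorable with
  2 and 3 colors. For the lower bound, \<open>{0, 1}\<close> is always an edge of the graph of \<open>\<int>\<^sub>n\<close>, and
  \<open>0, 1, \<dots>, n - 1, 0\<close> is a closed walk of length \<open>n\<close>, which excludes 2 colors for odd \<open>n\<close>.\<close>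

lemma chromatic_number_eqI:
  assumes "colorable G k" and "\<And>j. colorable G j \<Longrightarrow> k \<le> j"
  shows "chromatic_number G = enat k"
  unfolding chromatic_number_def
  using assms by (intro antisym INF_lower INF_greatest) auto

lemma colorable_pullback:
  assumes "colorable H k"
    and verts: "h \<in> verts G \<rightarrow> verts H"
    and edges: "\<And>a b. {a, b} \<in> edges G \<Longrightarrow> {h a, h b} \<in> edges H"
  shows "colorable G k"
proof -
  obtain c where "proper_coloring H k c"
    using assms(1) unfolding colorable_def by blast
  then have "proper_coloring G k (c \<circ> h)"
    using verts edges unfolding proper_coloring_def by (auto simp: Pi_iff)
  then show ?thesis
    unfolding colorable_def by blast
qed

text \<open>An edge is an unordered pair, so membership can be tested on either order of its ends only
  because \<open>(b - a)\<^sup>2 = (a - b)\<^sup>2\<close>.\<close>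

lemma involutory_cayley_edge_iff:
  assumes "cring R"
  shows "{a, b} \<in> edges (involutory_cayley_graph R) \<longleftrightarrow>
    a \<in> carrier R \<and> b \<in> carrier R \<and> a \<noteq> b \<and> (a \<ominus>\<^bsub>R\<^esub> b) [^]\<^bsub>R\<^esub> (2::nat) = \<one>\<^bsub>R\<^esub>"
proof -
  interpret cring R by fact
  have "(y \<ominus>\<^bsub>R\<^esub> x) [^]\<^bsub>R\<^esub> (2::nat) = (x \<ominus>\<^bsub>R\<^esub> y) [^]\<^bsub>R\<^esub> (2::nat)"
    if "x \<in> carrier R" "y \<in> carrier R" for x y
  proof -
    have "y \<ominus>\<^bsub>R\<^esub> x = \<ominus>\<^bsub>R\<^esub> (x \<ominus>\<^bsub>R\<^esub> y)"
      using that by (simp add: a_minus_def minus_add a_comm)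
    then show ?thesis
      using that by (simp add: numeral_2_eq_2 l_minus r_minus)
  qed
  then show ?thesis
    unfolding involutory_cayley_graph_def by (auto simp: doubleton_eq_iff)
qed

lemma colorable_ring_hom:
  assumes "cring R" and "cring S" and "\<one>\<^bsub>S\<^esub> \<noteq> \<zero>\<^bsub>S\<^esub>" and h: "h \<in> ring_hom R S"
    and "colorable (involutory_cayley_graph S) k"
  shows "colorable (involutory_cayley_graph R) k"
proof (rule colorable_pullback[where h = h, OF assms(5)])
  interpret ring_hom_cring R S h
    using assms by (simp add: ring_hom_cring.intro ring_hom_cring_axioms.intro)
  show "h \<in> verts (involutory_cayley_graph R) \<rightarrow> verts (involutory_cayley_graph S)"
    by (simp add: involutory_cayley_graph_def)
  show "{h a, h b} \<in> edges (involutory_cayley_graph S)"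
    if "{a, b} \<in> edges (involutory_cayley_graph R)" for a b
  proof -
    have ab: "a \<in> carrier R" "b \<in> carrier R"
      and sq: "(a \<ominus>\<^bsub>R\<^esub> b) [^]\<^bsub>R\<^esub> (2::nat) = \<one>\<^bsub>R\<^esub>"
      using that assms(1) by (auto simp: involutory_cayley_edge_iff)
    have "(h a \<ominus>\<^bsub>S\<^esub> h b) [^]\<^bsub>S\<^esub> (2::nat) = h ((a \<ominus>\<^bsub>R\<^esub> b) [^]\<^bsub>R\<^esub> (2::nat))"
      using ab by (simp add: a_minus_def)
    also have "\<dots> = \<one>\<^bsub>S\<^esub>"
      by (simp add: sq)
    finally have sq': "(h a \<ominus>\<^bsub>S\<^esub> h b) [^]\<^bsub>S\<^esub> (2::nat) = \<one>\<^bsub>S\<^esub>" .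
    \<comment> \<open>The images stay distinct: otherwise the equation above reads \<open>0 = 1\<close> in \<open>S\<close>.\<close>
    have "h a \<noteq> h b"
    proof
      assume "h a = h b"
      then have "h a \<ominus>\<^bsub>S\<^esub> h b = \<zero>\<^bsub>S\<^esub>"
        using ab by (simp add: S.r_right_minus_eq)
      with sq' show False
        using assms(3) by (simp add: numeral_2_eq_2)
    qed
    with sq' ab show ?thesis
      using assms(2) by (simp add: involutory_cayley_edge_iff)
  qed
qed

lemma (in UP_cring) constant_coeff_ring_hom: "(\<lambda>f. coeff P f 0) \<in> ring_hom P R"
  by (rule ring_hom_memI) simp_all

theorem chromatic_number_UP:
  assumes "cring R" and "\<one>\<^bsub>R\<^esub> \<noteq> \<zero>\<^bsub>R\<^esub>"
  shows "chromatic_number (involutory_cayley_graph (UP R)) =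
    chromatic_number (involutory_cayley_graph R)"
proof -
  interpret UP_cring R "UP R"
    using assms(1) by (simp_all add: UP_cring_def)
  have const: "(\<lambda>a. monom (UP R) a 0) \<in> ring_hom R (UP R)"
    by (rule const_ring_hom)
  have "\<one>\<^bsub>UP R\<^esub> \<noteq> \<zero>\<^bsub>UP R\<^esub>"
  proof
    assume "\<one>\<^bsub>UP R\<^esub> = \<zero>\<^bsub>UP R\<^esub>"
    then have "coeff (UP R) \<one>\<^bsub>UP R\<^esub> 0 = coeff (UP R) \<zero>\<^bsub>UP R\<^esub> 0"
      by (rule arg_cong)
    then show False
      using assms(2) by simp
  qed
  then have "colorable (involutory_cayley_graph (UP R)) k \<longleftrightarrow>
      colorable (involutory_cayley_graph R) k" for k
    using colorable_ring_hom[OF assms(1) P.is_cring _ const]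
      colorable_ring_hom[OF P.is_cring assms constant_coeff_ring_hom] by blast
  then show ?thesis
    by (simp add: chromatic_number_def)
qed

lemma residue_edge_iff:
  assumes "m > 1"
  shows "{a, b} \<in> edges (involutory_cayley_graph (residue_ring m)) \<longleftrightarrow>
    a \<in> {0..<m} \<and> b \<in> {0..<m} \<and> [(a - b)\<^sup>2 = 1] (mod m)"
proof -
  interpret residues m "residue_ring m"
    using assms by unfold_locales simp_all
  have "(a \<ominus>\<^bsub>residue_ring m\<^esub> b) = (a - b) mod m"
    by (simp add: a_minus_def res_neg_eq res_add_eq mod_simps)
  then have "(a \<ominus>\<^bsub>residue_ring m\<^esub> b) [^]\<^bsub>residue_ring m\<^esub> (2::nat) = (a - b)\<^sup>2 mod m"
    by (simp only: pow_cong)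
  moreover have "\<not> [(a - b)\<^sup>2 = 1] (mod m)" if "a = b"
    using that assms by (simp add: cong_def)
  ultimately show ?thesis
    using assms by (auto simp: involutory_cayley_edge_iff[OF cring] res_carrier_eq res_one_eq cong_def)
qed

lemma residue_mod_ring_hom:
  assumes "d > 1" and "m > 1" and "d dvd m"
  shows "(\<lambda>a. a mod d) \<in> ring_hom (residue_ring m) (residue_ring d)"
  using assms
  by (intro ring_hom_memI) (auto simp: residue_ring_def mod_mod_cancel mod_simps)

lemma colorable_residue_ring_dvd:
  assumes "d > 1" and "m > 1" and "d dvd m"
    and "colorable (involutory_cayley_graph (residue_ring d)) k"
  shows "colorable (involutory_cayley_graph (residue_ring m)) k"
proof -
  interpret d: residues d "residue_ring d"
    using assms by unfold_locales simp_all
  interpret m: residues m "residue_ring m"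
    using assms by unfold_locales simp_all
  show ?thesis
    using colorable_ring_hom[OF m.cring d.cring _ residue_mod_ring_hom] assms
    by (simp add: d.res_zero_eq d.res_one_eq)
qed

lemma colorable_residue_ring_2: "colorable (involutory_cayley_graph (residue_ring 2)) 2"
proof -
  have "proper_coloring (involutory_cayley_graph (residue_ring 2)) 2 nat"
    unfolding proper_coloring_def
  proof (intro conjI allI impI)
    show "nat \<in> verts (involutory_cayley_graph (residue_ring 2)) \<rightarrow> {..<2}"
      by (auto simp: involutory_cayley_graph_def residue_ring_def)
    show "nat a \<noteq> nat b" if "{a, b} \<in> edges (involutory_cayley_graph (residue_ring 2))" for a b
      using that by (auto simp: residue_edge_iff cong_def eq_nat_nat_iff)
  qed
  then show ?thesis
    unfolding colorable_def by blast
qed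

text \<open>The coloring of the cycle of odd length \<open>p\<close> alternates along \<open>0, 1, \<dots>, p - 2\<close> and spends
  the third color on the last vertex \<open>p - 1\<close>.\<close>

lemma colorable_residue_ring_prime:
  assumes "prime p" and "p > (2::int)"
  shows "colorable (involutory_cayley_graph (residue_ring p)) 3"
proof -
  define c :: "int \<Rightarrow> nat" where "c a = (if a = p - 1 then 2 else if even a then 0 else 1)" for a
  have "c a \<noteq> c b" if "{a, b} \<in> edges (involutory_cayley_graph (residue_ring p))" for a b
  proof -
    have ab: "a \<in> {0..<p}" "b \<in> {0..<p}" and sq: "[(a - b)\<^sup>2 = 1] (mod p)"
      using that assms(2) by (simp_all add: residue_edge_iff)
    have "p dvd (a - b - 1) * (a - b + 1)"
      using sq by (simp add: cong_iff_dvd_diff power2_eq_square algebra_simps)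
    then have "p dvd a - b - 1 \<or> p dvd a - b + 1"
      using assms(1) by (simp add: prime_dvd_mult_iff)
    \<comment> \<open>Both numbers lie in \<open>{-p..p}\<close>, so the only possible multiples of \<open>p\<close> are \<open>0\<close>, \<open>p\<close> and \<open>-p\<close>.\<close>
    moreover have "x = 0 \<or> x = p \<or> x = - p" if "p dvd x" "\<bar>x\<bar> \<le> p" for x
      using that zdvd_imp_le[of p x] zdvd_imp_le[of p "- x"] by fastforce
    ultimately have "a - b = 1 \<or> a - b = - 1 \<or> a - b = p - 1 \<or> a - b = 1 - p"
      using ab assms(2) by fastforce
    then have "a = b + 1 \<or> b = a + 1 \<or> a = p - 1 \<and> b = 0 \<or> a = 0 \<and> b = p - 1"
      using ab by auto
    then show ?thesis
      using ab assms(2) by (auto simp: c_def)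
  qed
  then have "proper_coloring (involutory_cayley_graph (residue_ring p)) 3 c"
    by (auto simp: proper_coloring_def c_def)
  then show ?thesis
    unfolding colorable_def by blast
qed

lemma colorable_residue_ring_ge_2:
  assumes "m > 1" and "colorable (involutory_cayley_graph (residue_ring m)) k"
  shows "k \<ge> 2"
proof -
  obtain c where c: "proper_coloring (involutory_cayley_graph (residue_ring m)) k c"
    using assms(2) unfolding colorable_def by blast
  have "{0, 1} \<in> edges (involutory_cayley_graph (residue_ring m))"
    using assms(1) by (simp add: residue_edge_iff)
  then have "c 0 \<noteq> c 1"
    using c by (simp add: proper_coloring_def)
  moreover have "c 0 < k" "c 1 < k"
    using c assms(1)
    by (auto simp: proper_coloring_def involutory_cayley_graph_def residue_ring_def)
  ultimately show ?thesis
    by linarith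
qed

text \<open>With two colors, the colors along the walk \<open>0, 1, \<dots>, n - 1\<close> have to alternate, so for odd
  \<open>n\<close> the adjacent vertices \<open>n - 1\<close> and \<open>0\<close> get the same color.\<close>

lemma colorable_residue_ring_odd_ge_3:
  assumes "n > 1" and "odd n" and "colorable (involutory_cayley_graph (residue_ring (int n))) k"
  shows "k \<ge> 3"
proof (rule ccontr)
  assume "\<not> k \<ge> 3"
  obtain c where c: "proper_coloring (involutory_cayley_graph (residue_ring (int n))) k c"
    using assms(3) unfolding colorable_def by blast
  have two: "c (int i) < 2" if "i < n" for i
  proof -
    have "c (int i) < k"
      using c that
      by (auto simp: proper_coloring_def involutory_cayley_graph_def residue_ring_def)
    with \<open>\<not> k \<ge> 3\<close> show ?thesis
      by linarith
  qed
  have alternate: "c (int i) = c 0 \<longleftrightarrow> even i" if "i < n" for i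
    using that
  proof (induction i)
    case (Suc i)
    have "{int i, int (Suc i)} \<in> edges (involutory_cayley_graph (residue_ring (int n)))"
      using Suc.prems by (simp add: residue_edge_iff)
    then have "c (int i) \<noteq> c (int (Suc i))"
      using c unfolding proper_coloring_def by blast
    moreover have "c 0 < 2" "c (int i) < 2" "c (int (Suc i)) < 2"
      using two[of 0] two[of i] two[of "Suc i"] Suc.prems by simp_all
    moreover have "c (int i) = c 0 \<longleftrightarrow> even i"
      using Suc by simp
    ultimately show ?case
      unfolding even_Suc by linarith
  qed simp
  have "[(int (n - 1) - 0)\<^sup>2 = 1] (mod int n)"
    using assms(1)
    by (simp add: cong_iff_dvd_diff of_nat_diff power2_eq_square algebra_simps)
  then have "{int (n - 1), 0} \<in> edges (involutory_cayley_graph (residue_ring (int n)))"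
    using assms(1) by (subst residue_edge_iff) auto
  then have "c (int (n - 1)) \<noteq> c 0"
    using c unfolding proper_coloring_def by blast
  then show False
    using alternate[of "n - 1"] assms(1,2) by simp
qed

lemma chromatic_number_residue_ring:
  assumes "n \<ge> 2"
  shows "chromatic_number (involutory_cayley_graph (residue_ring (int n))) =
    (if even n then 2 else 3)"
proof (cases "even n")
  case True
  have "colorable (involutory_cayley_graph (residue_ring (int n))) 2"
    using True assms by (intro colorable_residue_ring_dvd[OF _ _ _ colorable_residue_ring_2]) auto
  then have "chromatic_number (involutory_cayley_graph (residue_ring (int n))) = enat 2"
    using assms by (intro chromatic_number_eqI colorable_residue_ring_ge_2) auto
  with True show ?thesis
    by (simp add: numeral_eq_enat)
next
  case False
  obtain p where p: "prime p" "p dvd n"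
    using assms prime_factor_nat[of n] by auto
  with False have "p \<noteq> 2"
    by auto
  with p have "p > 2"
    using prime_ge_2_nat[of p] by simp
  have "colorable (involutory_cayley_graph (residue_ring (int p))) 3"
    using p \<open>p > 2\<close> by (intro colorable_residue_ring_prime) simp_all
  then have "colorable (involutory_cayley_graph (residue_ring (int n))) 3"
    using p \<open>p > 2\<close> assms by (intro colorable_residue_ring_dvd[of "int p" "int n"]) auto
  then have "chromatic_number (involutory_cayley_graph (residue_ring (int n))) = enat 3"
    using assms False by (intro chromatic_number_eqI colorable_residue_ring_odd_ge_3) auto
  with False show ?thesis
    by (simp add: numeral_eq_enat)
qed

theorem theorem3p6:
  fixes n :: nat
  assumes "n \<ge> 2"
  shows "chromatic_number (involutory_cayley_graph (UP (residue_ring (int n)))) =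
           chromatic_number (involutory_cayley_graph (residue_ring (int n)))
       \<and> chromatic_number (involutory_cayley_graph (residue_ring (int n))) =
           (if even n then 2 else 3)"
proof -
  interpret residues "int n" "residue_ring (int n)"
    using assms by unfold_locales simp_all
  show ?thesis
    using chromatic_number_UP[OF cring] chromatic_number_residue_ring[OF assms]
    by (simp add: res_zero_eq res_one_eq)
qed

end
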